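(* Let $m\in\mathbb{N}$, $k\in\mathbb{N}\setminus\{1\}$ and $a\in\mathbb{C}\setminus\{0,-1,-2,\ldots\}$. Then $$\sum_{n=1}^\infty\frac{H_n^{(m)}}{(n+a)\binom{n+k+a}{k}}=\sum_{r=1}^{k}(-1)^{r+1}\binom{k}{r}\left\{\begin{aligned}&\sum_{i=1}^{m-1}\frac{(-1)^{i-1}}{a^i}\zeta(m+1-i)-(-1)^m\frac{H_a}{a^m}\\&+\sum_{j=1}^{m-1}(-1)^{j-1}\zeta(m+1-j)H_{r-1}^{(j)}(a)\\&+(-1)^{m-1}H_aH_{r-1}^{(m)}(a)+(-1)^{m-1}\sum_{i=1}^{r-1}\frac{H_i^{(1)}(a)}{(i+a)^m}\end{aligned}\right\}.$$
   Context: $\mathbb{N}=\{1,2,3,\ldots\}$. For $n\in\mathbb{N}$, $H_n^{(m)}=\sum_{j=1}^n j^{-m}$. For $\alpha\in\mathbb{C}\setminus\{-1,-2,\ldots\}$, $H_\alpha=\psi(\alpha+1)+\gamma=\sum_{l=1}^\infty\left(\frac1l-\frac1{l+\alpha}\right)$ is the shifted harmonic number ($\psi$ the digamma function, $\gamma$ the Euler–Mascheroni constant). The parametric harmonic numbers are $H_n^{(s)}(c)=\sum_{j=1}^n (j+c)^{-s}$ for $n\ge 0$, $c\in\mathbb{C}\setminus\{-1,-2,\ldots\}$, so $H_0^{(s)}(c)=0$. $\zeta$ is the Riemann zeta function. For $u\in\mathbb{C}$ and $k\in\mathbb{N}$, $\binom{u}{k}=\frac{u(u-1)\cdots(u-k+1)}{k!}$.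 Empty sums are $0$. The series on the left is denoted $W_k^{(a,a)}(m,1)$ in the paper. *)

theory Defs
  imports "HOL-Analysis.Gamma_Function"
begin

definition gen_harm :: "nat \<Rightarrow> nat \<Rightarrow> complex" where
  "gen_harm m n = (\<Sum>j=1..n. 1 / of_nat j ^ m)"

text \<open>The shifted harmonic number \<open>H_\<alpha>\<close>, for \<open>\<alpha>\<close> not a negative integer.\<close>

definition shifted_harm :: "complex \<Rightarrow> complex" where
  "shifted_harm \<alpha> = Digamma (\<alpha> + 1) + euler_mascheroni"

text \<open>\<open>param_harm s c n\<close> is \<open>H_n^{(s)}(c)\<close>, for \<open>c\<close> not a negative integer.\<close>

definition param_harm :: "nat \<Rightarrow> complex \<Rightarrow> nat \<Rightarrow> complex" where
  "param_harm s c n = (\<Sum>j=1..n. 1 / (of_nat j + c) ^ s)"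

text \<open>
  The Riemann zeta function on its half-plane of convergence \<open>Re s > 1\<close>; the value is
  meaningless elsewhere, as no analytic continuation is performed.
\<close>

definition riemann_zeta :: "complex \<Rightarrow> complex" where
  "riemann_zeta s = (\<Sum>n. of_nat (Suc n) powr (- s))"

end

theory Submission imports Defs begin

text \<open>
  Since \<open>1 / binom(x + k, k) = k! / ((x + 1) \<cdots> (x + k))\<close>, the kernel
  \<open>1 / (x binom(x + k, k))\<close> has the partial fraction expansion
  \<open>\<Sum>r\<le>k. (-1)\<^sup>r binom(k, r) / (x + r)\<close>. The alternating binomial coefficients
  sum to \<open>0\<close>, so it is a combination of the differences \<open>1 / x - 1 / (x + r)\<close> with
  \<open>1 \<le> r \<le> k\<close> (\<open>inverse_gbinomial_partial_fractions\<close>).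
  With \<open>x = n + a\<close> each difference is \<open>O(n\<^sup>-\<^sup>2)\<close>,
  so the series splits into one convergent series for each \<open>r\<close>, even for \<open>m = 1\<close>.

  Such a difference is the telescoping sum over \<open>s < r\<close> of
  \<open>1 / (n + b) - 1 / (n + b + 1)\<close> with \<open>b = a + s\<close>. For one unit step, summation
  by parts (\<open>sums_Abel\<close>) trades the harmonic number for its increment:
  \<open>\<Sum>n. H_n^{(m)} (1 / (n + b) - 1 / (n + b + 1)) = \<Sum>n. 1 / (n\<^sup>m (n + b))\<close>.
  The boundary term vanishes because \<open>H_n^{(m)}\<close> grows at most logarithmically.

  The remaining series \<open>T_m(b)\<close> satisfies \<open>T_{m+1}(b) = (\<zeta>(m + 1) - T_m(b)) / b\<close>,
  again by partial fractions, and \<open>T_1(b) = H_b / b\<close> is \<open>1 / b\<close> times the defining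
  series of the shifted harmonic number. Unrolling the recursion (\<open>sum_inverse_power_times_linear\<close>) gives
  zeta values times powers of \<open>1 / b\<close>, plus \<open>\<plusminus> H_b / b\<^sup>m\<close>. In the sum over
  \<open>b = a, a + 1, \<dots>, a + r - 1\<close> the powers of \<open>1 / b\<close> with \<open>s \<ge> 1\<close> add up to parametric harmonic numbers, and
  \<open>H_{a+s} = H_a + H_s^{(1)}(a)\<close> separates the last two terms of the
  formula (\<open>sum_gen_harm_shifted_difference\<close>).
\<close>

section \<open>Partial fractions of the binomial kernel\<close>

lemma add_of_nat_notin_nonpos_Ints:
  fixes x :: "'a :: ring_char_0"
  assumes "x \<notin> \<int>\<^sub>\<le>\<^sub>0"
  shows "x + of_nat n \<notin> \<int>\<^sub>\<le>\<^sub>0"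
proof (induction n)
  case (Suc n)
  then show ?case
    using plus_one_in_nonpos_Ints_imp[of "x + of_nat n"] by (auto simp: add_ac)
qed (use assms in simp)

text \<open>
  Write \<open>F_k(x)\<close> for the left-hand side. Then \<open>F_{k+1}(x) = F_k(x) - F_k(x + 1)\<close>, so
  \<open>F_k\<close> is up to sign the \<open>k\<close>-th finite difference of \<open>1 / x\<close>; the induction step is
  Pascal's rule.
\<close>
lemma partial_fractions_pochhammer:
  fixes x :: "'a :: field_char_0"
  assumes "x \<notin> \<int>\<^sub>\<le>\<^sub>0"
  shows "fact k / pochhammer x (Suc k) = (\<Sum>r\<le>k. (-1) ^ r * of_nat (k choose r) / (x + of_nat r))"
  using assms
proof (induction k arbitrary: x)
  case 0
  then show ?case by simp
next
  case (Suc k)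
  define f where "f r = 1 / (x + of_nat r)" for r
  have x1: "x + 1 \<notin> \<int>\<^sub>\<le>\<^sub>0"
    using Suc.prems plus_one_in_nonpos_Ints_imp by blast
  have "pochhammer x n \<noteq> 0" for n
    using Suc.prems by (auto simp: pochhammer_eq_0_iff)
  note nz = this[of "Suc (Suc k)"]
  have R: "pochhammer x (Suc (Suc k)) = pochhammer x (Suc k) * (x + of_nat (Suc k))"
          "pochhammer x (Suc (Suc k)) = x * pochhammer (x + 1) (Suc k)"
    by (rule pochhammer_Suc, rule pochhammer_rec)
  have "fact k / pochhammer x (Suc k) - fact k / pochhammer (x + 1) (Suc k)
          = fact k * (x + of_nat (Suc k)) / pochhammer x (Suc (Suc k))
            - fact k * x / pochhammer x (Suc (Suc k))"
  proof -
    have "fact k / pochhammer x (Suc k)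
        = fact k * (x + of_nat (Suc k)) / pochhammer x (Suc (Suc k))"
      using nz unfolding R(1) by (simp only: mult_eq_0_iff de_Morgan_disj) simp
    moreover have "fact k / pochhammer (x + 1) (Suc k) = fact k * x / pochhammer x (Suc (Suc k))"
      using nz unfolding R(2) by (simp only: mult_eq_0_iff de_Morgan_disj) simp
    ultimately show ?thesis by simp
  qed
  also have "\<dots> = fact (Suc k) / pochhammer x (Suc (Suc k))"
    by (simp add: diff_divide_distrib [symmetric] algebra_simps)
  finally have "fact (Suc k) / pochhammer x (Suc (Suc k))
      = (\<Sum>r\<le>k. (-1) ^ r * of_nat (k choose r) * f r)
        - (\<Sum>r\<le>k. (-1) ^ r * of_nat (k choose r) * f (Suc r))"
    using Suc.IH[OF Suc.prems] Suc.IH[OF x1] by (simp add: f_def add_ac)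
  also have "(\<Sum>r\<le>k. (-1) ^ r * of_nat (k choose r) * f r)
      = (\<Sum>r\<le>Suc k. (-1) ^ r * of_nat (k choose r) * f r)"
    by simp
  also have "\<dots> = f 0 - (\<Sum>r\<le>k. (-1) ^ r * of_nat (k choose Suc r) * f (Suc r))"
    by (subst sum.atMost_Suc_shift) (simp add: sum_negf)
  also have "\<dots> - (\<Sum>r\<le>k. (-1) ^ r * of_nat (k choose r) * f (Suc r))
      = f 0 + (\<Sum>r\<le>k. (-1) ^ Suc r * of_nat (Suc k choose Suc r) * f (Suc r))"
    by (simp add: sum_negf sum.distrib sum_subtractf ring_distribs)
  also have "\<dots> = (\<Sum>r\<le>Suc k. (-1) ^ r * of_nat (Suc k choose r) * f r)"
    by (subst sum.atMost_Suc_shift) simp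
  finally show ?case by (simp add: f_def)
qed

text \<open>
  Subtracting \<open>1 / x\<close> from every term is harmless because the coefficients sum to \<open>0\<close> for
  \<open>k \<ge> 1\<close>. It makes each summand \<open>O(x\<^sup>-\<^sup>2)\<close>, whereas the terms \<open>1 / (x + r)\<close> on their own
  would lead to divergent series.
\<close>
lemma inverse_gbinomial_partial_fractions:
  fixes x :: "'a :: field_char_0"
  assumes "x \<notin> \<int>\<^sub>\<le>\<^sub>0" and "k \<ge> 1"
  shows "1 / (x * ((x + of_nat k) gchoose k))
           = (\<Sum>r=1..k. (-1) ^ (r + 1) * of_nat (k choose r) * (1 / x - 1 / (x + of_nat r)))"
proof -
  have "1 / (x * ((x + of_nat k) gchoose k)) = fact k / pochhammer x (Suc k)"
    by (simp add: gbinomial_pochhammer' pochhammer_rec)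
  also have "\<dots> = (\<Sum>r\<le>k. (-1) ^ r * of_nat (k choose r) * (1 / (x + of_nat r)))"
    using partial_fractions_pochhammer[OF assms(1), of k] by simp
  also have "\<dots> = (\<Sum>r\<le>k. (-1) ^ r * of_nat (k choose r) * (1 / (x + of_nat r)))
                 - (\<Sum>r\<le>k. (-1) ^ r * of_nat (k choose r)) * (1 / x)"
    using assms(2) by (simp add: choose_alternating_sum)
  also have "\<dots> = (\<Sum>r\<le>k. (-1) ^ (r + 1) * of_nat (k choose r) * (1 / x - 1 / (x + of_nat r)))"
    unfolding sum_distrib_right sum_subtractf [symmetric]
    by (rule sum.cong) (simp_all add: right_diff_distrib)
  also have "\<dots> = (\<Sum>r=1..k. (-1) ^ (r + 1) * of_nat (k choose r) * (1 / x - 1 / (x + of_nat r)))"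
    by (rule sum.mono_neutral_right) (auto simp: not_less_eq_eq)
  finally show ?thesis .
qed

section \<open>Summation by parts\<close>

lemma sums_Abel:
  fixes u v :: "nat \<Rightarrow> 'a :: real_normed_field"
  assumes "(\<lambda>n. u n * v n) sums S"
    and "(\<lambda>n. (\<Sum>k<n. u k) * v n) \<longlonglongrightarrow> 0"
  shows "(\<lambda>n. (\<Sum>k<Suc n. u k) * (v n - v (Suc n))) sums S"
proof -
  have "(\<Sum>n<N. (\<Sum>k<Suc n. u k) * (v n - v (Suc n)))
          = (\<Sum>n<N. u n * v n) - (\<Sum>k<N. u k) * v N" for N
    by (induction N) (simp_all add: algebra_simps)
  moreover have "(\<lambda>N. (\<Sum>n<N. u n * v n) - (\<Sum>k<N. u k) * v N) \<longlonglongrightarrow> S - 0"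
    using assms unfolding sums_def by (intro tendsto_diff)
  ultimately show ?thesis
    by (simp add: sums_def)
qed

text \<open>
  This is the boundary term of the summation by parts in
  \<open>sum_gen_harm_difference\<close>. The worst case is \<open>m = 1\<close>, where \<open>H_n = ln n + O(1)\<close> is
  still \<open>o(n)\<close>; for larger \<open>m\<close> the harmonic numbers are only smaller.
\<close>
lemma gen_harm_over_linear_tendsto_0:
  assumes "m \<ge> 1"
  shows "(\<lambda>n. gen_harm m n / (of_nat n + c)) \<longlonglongrightarrow> 0"
proof (rule Lim_null_comparison)
  have "(\<lambda>n. harm n - ln (real n)) \<longlonglongrightarrow> euler_mascheroni"
    by (rule euler_mascheroni_LIMSEQ)
  then have "(\<lambda>n. (harm n - ln (real n)) * inverse (real n) + ln (real n) / real n)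
      \<longlonglongrightarrow> euler_mascheroni * 0 + 0"
    by (intro tendsto_add tendsto_mult lim_ln_over_n lim_inverse_n)
  then have "(\<lambda>n. harm n / real n) \<longlonglongrightarrow> 0"
    by (simp add: left_diff_distrib divide_inverse)
  from tendsto_mult_left[OF this, of 2] show "(\<lambda>n. 2 * (harm n / real n)) \<longlonglongrightarrow> 0"
    by simp
  show "\<forall>\<^sub>F n in sequentially. norm (gen_harm m n / (of_nat n + c)) \<le> 2 * (harm n / real n)"
    \<comment> \<open>Beyond this threshold \<open>norm (n + c) \<ge> n / 2\<close>, whence the factor \<open>2\<close>.\<close>
    using eventually_gt_at_top[of "nat \<lceil>2 * norm c\<rceil>"]
  proof eventually_elim
    case (elim n)
    have n: "2 * norm c < real n" "0 < n"
      using elim by linarith+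
    have "real n - norm c \<le> norm (of_nat n + c)"
      using norm_diff_ineq[of "of_nat n" c] by simp
    with n have den: "real n / 2 \<le> norm (of_nat n + c)"
      by simp
    have "norm (1 / of_nat j ^ m :: complex) \<le> inverse (real j)" if "j \<in> {1..n}" for j
    proof -
      have "real j ^ 1 \<le> real j ^ m"
        using that assms by (intro power_increasing) auto
      then show ?thesis
        using that by (simp add: norm_divide norm_power inverse_eq_divide frac_le)
    qed
    then have "norm (gen_harm m n) \<le> harm n"
      unfolding gen_harm_def harm_def by (rule sum_norm_le)
    then have "norm (gen_harm m n / (of_nat n + c)) \<le> harm n / (real n / 2)"
      unfolding norm_divide using den n by (intro frac_le) (auto intro: harm_nonneg)
    then show ?case by (simp add: mult.commute)
  qed
qed

lemma gen_harm_eq_sum_lessThan: "gen_harm m n = (\<Sum>j<n. 1 / of_nat (Suc j) ^ m)"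
  unfolding gen_harm_def by (rule sum.reindex_bij_witness[of _ Suc "\<lambda>j. j - 1"]) auto

section \<open>The series of reciprocals of \<open>n\<^sup>m (n + b)\<close>\<close>

lemma riemann_zeta_sums:
  assumes "q \<ge> 2"
  shows "(\<lambda>n. 1 / of_nat (Suc n) ^ q) sums riemann_zeta (of_nat q)"
proof -
  have eq: "of_nat (Suc n) powr (- of_nat q) = (1 / of_nat (Suc n) ^ q :: complex)" for n
    by (simp only: powr_minus_divide powr_nat' of_nat_neq_0 simp_thms not_False_eq_True)
  have "summable (\<lambda>n. inverse (of_nat n ^ q :: complex))"
    by (rule inverse_power_summable[OF assms])
  then have "summable (\<lambda>n. 1 / of_nat (Suc n) ^ q :: complex)"
    by (subst (asm) summable_Suc_iff [symmetric]) (simp add: inverse_eq_divide)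
  then show ?thesis
    unfolding riemann_zeta_def eq by (rule summable_sums)
qed

lemma inverse_difference_over_gap:
  fixes N b :: "'a :: field"
  assumes "N \<noteq> 0" "N + b \<noteq> 0" "b \<noteq> 0"
  shows "(1 / N - 1 / (N + b)) / b = 1 / (N * (N + b))"
  using assms by (simp add: diff_frac_eq)

text \<open>
  By \<open>1 / (n (n + b)) = (1 / n - 1 / (n + b)) / b\<close> this is \<open>1 / b\<close> times the series of the digamma function
  at \<open>b + 1\<close>, in which Euler's constant cancels the one in the shifted harmonic number.
\<close>
lemma shifted_harm_sums:
  assumes "b \<notin> \<int>\<^sub>\<le>\<^sub>0"
  shows "(\<lambda>n. 1 / (of_nat (Suc n) * (of_nat (Suc n) + b))) sums (shifted_harm b / b)"
proof -
  have b: "b \<noteq> 0" "of_nat (Suc n) + b \<noteq> 0" for n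
    using assms plus_of_nat_eq_0_imp[of b "Suc n"] by (auto simp: add_ac)
  have "b + 1 \<noteq> 0"
    using b(2)[of 0] by (simp add: add_ac)
  from summable_sums[OF summable_Digamma[OF this]]
  have "(\<lambda>n. inverse (of_nat (Suc n)) - inverse (b + 1 + of_nat n)) sums shifted_harm b"
    by (simp add: shifted_harm_def Digamma_def)
  then have "(\<lambda>n. (inverse (of_nat (Suc n)) - inverse (b + 1 + of_nat n)) / b) sums (shifted_harm b / b)"
    by (rule sums_divide)
  moreover have "(inverse (of_nat (Suc n)) - inverse (b + 1 + of_nat n)) / b
      = 1 / (of_nat (Suc n) * (of_nat (Suc n) + b))" for n
  proof -
    define N :: complex where "N = of_nat (Suc n)"
    have eq: "b + 1 + of_nat n = N + b" by (simp add: N_def)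
    have "N \<noteq> 0" "N + b \<noteq> 0"
      unfolding N_def using b(2) of_nat_neq_0 by blast+
    then show ?thesis
      unfolding eq unfolding N_def [symmetric]
      using inverse_difference_over_gap[of N b] b(1) by (simp add: inverse_eq_divide)
  qed
  ultimately show ?thesis by simp
qed

lemma shifted_harm_add_of_nat:
  assumes "a \<notin> \<int>\<^sub>\<le>\<^sub>0"
  shows "shifted_harm (a + of_nat s) = shifted_harm a + param_harm 1 a s"
proof (induction s)
  case 0
  then show ?case by (simp add: param_harm_def)
next
  case (Suc s)
  have "a + of_nat s + 1 \<noteq> 0"
    using assms plus_of_nat_eq_0_imp[of a "Suc s"] by (auto simp: add_ac)
  from Digamma_plus1[OF this] Suc show ?case
    by (simp add: shifted_harm_def param_harm_def add_ac)
qed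

text \<open>
  Induction on \<open>m\<close>: the identity
  \<open>1 / (n\<^sup>m\<^sup>+\<^sup>1 (n + b)) = (1 / n\<^sup>m\<^sup>+\<^sup>1 - 1 / (n\<^sup>m (n + b))) / b\<close> splits off the
  zeta value at \<open>m + 1 \<ge> 2\<close> and divides the previous value by \<open>-b\<close>.
\<close>
lemma sum_inverse_power_times_linear:
  assumes "b \<notin> \<int>\<^sub>\<le>\<^sub>0" and "m \<ge> 1"
  shows "(\<lambda>n. 1 / (of_nat (Suc n) ^ m * (of_nat (Suc n) + b))) sums
           ((\<Sum>i=1..m-1. (-1) ^ (i - 1) * riemann_zeta (of_nat (m + 1 - i)) / b ^ i)
            + (-1) ^ (m - 1) * shifted_harm b / b ^ m)"
  using assms(2)
proof (induction m rule: dec_induct)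
  case base
  then show ?case using shifted_harm_sums[OF assms(1)] by simp
next
  case (step m)
  let ?S = "(\<Sum>i=1..m-1. (-1) ^ (i - 1) * riemann_zeta (of_nat (m + 1 - i)) / b ^ i)"
  have b: "b \<noteq> 0" "of_nat (Suc n) + b \<noteq> 0" for n
    using assms(1) plus_of_nat_eq_0_imp[of b "Suc n"] by (auto simp: add_ac)
  have "(\<lambda>n. (1 / of_nat (Suc n) ^ Suc m - 1 / (of_nat (Suc n) ^ m * (of_nat (Suc n) + b))) / b)
      sums ((riemann_zeta (of_nat (Suc m)) - (?S + (-1) ^ (m - 1) * shifted_harm b / b ^ m)) / b)"
    using step by (intro sums_divide sums_diff riemann_zeta_sums) auto
  moreover have "(1 / of_nat (Suc n) ^ Suc m - 1 / (of_nat (Suc n) ^ m * (of_nat (Suc n) + b))) / b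
      = 1 / (of_nat (Suc n) ^ Suc m * (of_nat (Suc n) + b))" for n
  proof -
    define N :: complex where "N = of_nat (Suc n)"
    have "N \<noteq> 0" "N + b \<noteq> 0" "b \<noteq> 0"
      unfolding N_def using b of_nat_neq_0 by blast+
    from inverse_difference_over_gap[OF this]
    have "(1 / N - 1 / (N + b)) / b * (1 / N ^ m) = 1 / (N * (N + b)) * (1 / N ^ m)"
      by (simp only:)
    then show ?thesis
      unfolding N_def [symmetric]
      by (simp add: diff_divide_distrib left_diff_distrib mult_ac)
  qed
  moreover have "(riemann_zeta (of_nat (Suc m)) - (?S + (-1) ^ (m - 1) * shifted_harm b / b ^ m)) / b
      = (\<Sum>i=1..Suc m-1. (-1) ^ (i - 1) * riemann_zeta (of_nat (Suc m + 1 - i)) / b ^ i)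
        + (-1) ^ (Suc m - 1) * shifted_harm b / b ^ Suc m"
  proof -
    let ?f = "\<lambda>i. (-1) ^ (i - 1) * riemann_zeta (of_nat (Suc m + 1 - i)) / b ^ i"
    have "sum g {1..Suc m-1} = g 1 + (\<Sum>i=1..m-1. g (Suc i))" for g :: "nat \<Rightarrow> complex"
    proof -
      have "sum g {1..m} = g 1 + sum g {Suc 1..Suc (m - 1)}"
        using step(1) sum.atLeast_Suc_atMost[of 1 m g] by simp
      then show ?thesis
        by (simp only: sum.shift_bounds_cl_Suc_ivl diff_Suc_1)
    qed
    from this[of ?f] have "(\<Sum>i=1..Suc m-1. ?f i) = ?f 1 + (\<Sum>i=1..m-1. ?f (Suc i))" .
    also have "(\<Sum>i=1..m-1. ?f (Suc i)) = - (?S / b)"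
      unfolding sum_divide_distrib sum_negf [symmetric]
    proof (rule sum.cong)
      fix i assume "i \<in> {1..m-1}"
      then obtain j where "i = Suc j" by (cases i) auto
      then show "?f (Suc i) = - ((-1) ^ (i - 1) * riemann_zeta (of_nat (m + 1 - i)) / b ^ i / b)"
        by (simp add: mult_ac)
    qed simp
    finally have "(\<Sum>i=1..Suc m-1. ?f i) = riemann_zeta (of_nat (Suc m)) / b - ?S / b"
      by simp
    moreover have "(-1) ^ (Suc m - 1) * shifted_harm b / b ^ Suc m
        = - ((-1) ^ (m - 1) * shifted_harm b / b ^ m / b)"
      using step(1) by (cases m) (simp_all add: mult_ac)
    moreover have "(z - (s + h)) / b = z / b - s / b + - (h / b)" for z s h :: complex
      by (simp add: diff_divide_distrib add_divide_distrib)
    ultimately show ?thesis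
      by (simp only:)
  qed
  ultimately show ?case by (simp only:)
qed

section \<open>Harmonic numbers against differences of reciprocals\<close>

text \<open>
  Summation by parts with \<open>u n = 1 / (n + 1)\<^sup>m\<close> and \<open>v n = 1 / (n + 1 + b)\<close>: the partial sums
  of \<open>u\<close> are the harmonic numbers, and \<open>\<Sum>n. u n * v n\<close> is the series evaluated above.
\<close>
lemma sum_gen_harm_difference:
  assumes "b \<notin> \<int>\<^sub>\<le>\<^sub>0" and "m \<ge> 1"
  shows "(\<lambda>n. gen_harm m (Suc n) * (1 / (of_nat (Suc n) + b) - 1 / (of_nat (Suc n) + (b + 1)))) sums
           ((\<Sum>i=1..m-1. (-1) ^ (i - 1) * riemann_zeta (of_nat (m + 1 - i)) / b ^ i)
            + (-1) ^ (m - 1) * shifted_harm b / b ^ m)" (is "_ sums ?S")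
proof -
  let ?u = "\<lambda>n. 1 / of_nat (Suc n) ^ m :: complex"
  let ?v = "\<lambda>n. 1 / (of_nat (Suc n) + b)"
  have "(\<lambda>n. ?u n * ?v n) sums ?S"
    using sum_inverse_power_times_linear[OF assms] by simp
  moreover have "(\<lambda>n. (\<Sum>k<n. ?u k) * ?v n) \<longlonglongrightarrow> 0"
    using gen_harm_over_linear_tendsto_0[OF assms(2), of "1 + b"]
    by (simp add: gen_harm_eq_sum_lessThan add_ac)
  ultimately have "(\<lambda>n. (\<Sum>k<Suc n. ?u k) * (?v n - ?v (Suc n))) sums ?S"
    by (rule sums_Abel)
  then show ?thesis
    unfolding gen_harm_eq_sum_lessThan by (simp add: add_ac)
qed

text \<open>
  Telescoping reduces the gap \<open>r\<close> to unit steps at \<open>b = a + s\<close> for \<open>s < r\<close>. In the result the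
  step \<open>s = 0\<close> stays apart: it gives the two terms with explicit powers of \<open>a\<close>, because
  \<open>H_n^{(j)}(a)\<close> starts with \<open>1 / (a + 1)\<^sup>j\<close>.
\<close>
lemma sum_gen_harm_shifted_difference:
  assumes "a \<notin> \<int>\<^sub>\<le>\<^sub>0" and "m \<ge> 1" and "r \<ge> 1"
  shows "(\<lambda>n. gen_harm m (Suc n) * (1 / (of_nat (Suc n) + a) - 1 / (of_nat (Suc n) + a + of_nat r))) sums
           ((\<Sum>i=1..m-1. (-1) ^ (i - 1) / a ^ i * riemann_zeta (of_nat (m + 1 - i)))
             - (-1) ^ m * (shifted_harm a / a ^ m)
             + (\<Sum>j=1..m-1. (-1) ^ (j - 1) * riemann_zeta (of_nat (m + 1 - j))
                             * param_harm j a (r - 1))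
             + (-1) ^ (m - 1) * shifted_harm a * param_harm m a (r - 1)
             + (-1) ^ (m - 1) * (\<Sum>i=1..r-1. param_harm 1 a i / (of_nat i + a) ^ m))"
  (is "_ sums ?R")
proof -
  let ?T = "\<lambda>b. (\<Sum>i=1..m-1. (-1) ^ (i - 1) * riemann_zeta (of_nat (m + 1 - i)) / b ^ i)
            + (-1) ^ (m - 1) * shifted_harm b / b ^ m"
  let ?g = "\<lambda>n s. 1 / (of_nat (Suc n) + (a + of_nat s))"
  have "(\<lambda>n. \<Sum>s<r. gen_harm m (Suc n) * (?g n s - ?g n (Suc s))) sums (\<Sum>s<r. ?T (a + of_nat s))"
  proof (rule sums_sum)
    fix s
    have "a + of_nat s \<notin> \<int>\<^sub>\<le>\<^sub>0"
      using assms(1) add_of_nat_notin_nonpos_Ints by blast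
    from sum_gen_harm_difference[OF this assms(2)]
    show "(\<lambda>n. gen_harm m (Suc n) * (?g n s - ?g n (Suc s))) sums ?T (a + of_nat s)"
      by (simp add: add_ac)
  qed
  moreover have "(\<Sum>s<r. gen_harm m (Suc n) * (?g n s - ?g n (Suc s)))
      = gen_harm m (Suc n) * (1 / (of_nat (Suc n) + a) - 1 / (of_nat (Suc n) + a + of_nat r))" for n
  proof -
    have "(\<Sum>s<r. ?g n s - ?g n (Suc s)) = ?g n 0 - ?g n r"
      by (rule sum_lessThan_telescope')
    then show ?thesis
      unfolding sum_distrib_left [symmetric] by (simp only: of_nat_0 add_0_right add.assoc)
  qed
  moreover have "(\<Sum>s<r. ?T (a + of_nat s)) = ?R"
  proof -
    have "{..<r} = insert 0 {1..r-1}" using assms(3) by auto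
    then have "(\<Sum>s<r. ?T (a + of_nat s)) = ?T a + (\<Sum>s=1..r-1. ?T (a + of_nat s))"
      by simp
    also have "(\<Sum>s=1..r-1. ?T (a + of_nat s))
        = (\<Sum>s=1..r-1. \<Sum>j=1..m-1. (-1) ^ (j - 1) * riemann_zeta (of_nat (m + 1 - j)) * (1 / (of_nat s + a) ^ j))
        + (\<Sum>s=1..r-1. (-1) ^ (m - 1) * shifted_harm a * (1 / (of_nat s + a) ^ m))
        + (\<Sum>s=1..r-1. (-1) ^ (m - 1) * (param_harm 1 a s / (of_nat s + a) ^ m))"
      by (simp add: shifted_harm_add_of_nat[OF assms(1)] sum.distrib [symmetric] add_divide_distrib
          ring_distribs add_ac)
    also have "(\<Sum>s=1..r-1. \<Sum>j=1..m-1. (-1) ^ (j - 1) * riemann_zeta (of_nat (m + 1 - j)) * (1 / (of_nat s + a) ^ j))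
        = (\<Sum>j=1..m-1. (-1) ^ (j - 1) * riemann_zeta (of_nat (m + 1 - j)) * param_harm j a (r - 1))"
      unfolding param_harm_def sum_distrib_left by (rule sum.swap)
    finally show ?thesis
      using assms(2) by (cases m) (simp_all add: param_harm_def sum_distrib_left mult_ac)
  qed
  ultimately show ?thesis by (simp only:)
qed

theorem theorem4p3:
  fixes m k :: nat and a :: complex
  assumes "m \<ge> 1" and "k \<ge> 2" and "a \<notin> \<int>\<^sub>\<le>\<^sub>0"
  shows "(\<lambda>n. gen_harm m (Suc n) /
            ((of_nat (Suc n) + a) * ((of_nat (Suc n) + of_nat k + a) gchoose k)))
         sums
         (\<Sum>r=1..k. (-1) ^ (r + 1) * of_nat (k choose r) *
            ((\<Sum>i=1..m-1. (-1) ^ (i - 1) / a ^ i * riemann_zeta (of_nat (m + 1 - i)))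
             - (-1) ^ m * (shifted_harm a / a ^ m)
             + (\<Sum>j=1..m-1. (-1) ^ (j - 1) * riemann_zeta (of_nat (m + 1 - j))
                             * param_harm j a (r - 1))
             + (-1) ^ (m - 1) * shifted_harm a * param_harm m a (r - 1)
             + (-1) ^ (m - 1) * (\<Sum>i=1..r-1. param_harm 1 a i / (of_nat i + a) ^ m)))"
  (is "?lhs sums (\<Sum>r=1..k. ?c r * ?R r)")
proof -
  have lhs: "?lhs n = (\<Sum>r=1..k. ?c r * (gen_harm m (Suc n) *
      (1 / (of_nat (Suc n) + a) - 1 / (of_nat (Suc n) + a + of_nat r))))" for n
  proof -
    let ?x = "of_nat (Suc n) + a"
    have "?x \<notin> \<int>\<^sub>\<le>\<^sub>0"
      using add_of_nat_notin_nonpos_Ints[OF assms(3), of "Suc n"] by (metis add.commute)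
    from inverse_gbinomial_partial_fractions[OF this, of k] assms(2)
    have "gen_harm m (Suc n) * (1 / (?x * ((?x + of_nat k) gchoose k)))
        = gen_harm m (Suc n) * (\<Sum>r=1..k. ?c r * (1 / ?x - 1 / (?x + of_nat r)))"
      by (simp only:)
    moreover have "?x + of_nat k = of_nat (Suc n) + of_nat k + a"
      by (simp add: add_ac)
    ultimately show ?thesis
      by (simp only: sum_distrib_left mult.left_commute times_divide_eq_right mult_1_right)
  qed
  show ?thesis
    unfolding lhs
    by (intro sums_sum sums_mult sum_gen_harm_shifted_difference assms) simp
qed

end
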